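(* Let $u^A,u^B>0$, $q>0$, $p<0$ and $\alpha\in[0,1]$, and consider the two-player all-pay auction with favoritism with these parameters. Distributions on $[0,\infty)$ are given by their cumulative distribution functions. (i) If $(u^A+p)/q\le 0$, there exists a unique pure equilibrium; in it the bids are $x^A=x^B=0$ and the equilibrium payoffs are $\Pi^A=0$ and $\Pi^B=u^B$. (ii) If $0<(u^A+p)/q\le u^B$, there exists no pure equilibrium, and there is a mixed equilibrium in which Player A draws her bid from the distribution $F_{A_2^-}$ and Player B draws her bid from the distribution $F_{B_2^-}$, where $$F_{A_2^-}(x)=\begin{cases}1-\frac{u^A}{q u^B}-\frac{p}{q u^B}, & x\in[0,-p),\\ 1-\frac{u^A}{q u^B}+\frac{x}{q u^B}, & x\in[-p,u^A],\\ 1,& x>u^A,\end{cases}\qquad F_{B_2^-}(x)=\begin{cases}-\frac{p}{u^A}+\frac{q x}{u^A}, & x\in[0,\frac{u^A+p}{q}],\\ 1,& x>\frac{u^A+p}{q}.\end{cases}$$ In this mixed equilibrium the payoffs are $\Pi^A=0$ and $\Pi^B=u^B-(u^A+p)/q$. (iii) If $(u^A+p)/q>u^B$, there exists no pure equilibrium, and there is a mixed equilibrium in which Player A draws her bid from the distribution $F_{A_3^-}$ and Player B draws her bid from the distribution $F_{B_3^-}$, where $$F_{A_3^-}(x)=\begin{cases}0, & x\in[0,-p),\\ \frac{p}{q u^B}+\frac{x}{q u^B}, & x\in[-p,q u^B-p],\\ 1,& x>q u^B-p,\end{cases}\qquad F_{B_3^-}(x)=\begin{cases}1-\frac{q u^B}{u^A}+\frac{q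 x}{u^A}, & x\in[0,u^B],\\ 1,& x>u^B.\end{cases}$$ In this mixed equilibrium the payoffs are $\Pi^A=u^A-q u^B+p$ and $\Pi^B=0$.
   Context: All-pay auction with favoritism: a two-player simultaneous-move complete-information game with parameters $u^A,u^B>0$ (values of the item to Players A and B), $p\in\mathbb{R}$, $q>0$, $\alpha\in[0,1]$. Each player chooses a bid in $[0,\infty)$. Define $\beta(x,y)=1$ if $x>y$, $\beta(x,y)=\alpha$ if $x=y$, $\beta(x,y)=0$ if $x<y$. When the bids are $x^A,x^B\ge 0$ the payoffs are $$\Pi^A(x^A,x^B)=u^A\,\beta(x^A,qx^B-p)-x^A,\qquad \Pi^B(x^A,x^B)=u^B\,[1-\beta(x^A,qx^B-p)]-x^B.$$ A mixed strategy is a probability distribution on $[0,\infty)$; the players randomize independently and payoffs of mixed strategies are expected payoffs. "Equilibrium" means Nash equilibrium; a pure equilibrium is one in which both players use pure strategies (deterministic bids). *)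

theory Defs
  imports "HOL-Probability.Probability"
begin

definition beta :: "real \<Rightarrow> real \<Rightarrow> real \<Rightarrow> real" where
  "beta \<alpha> x y = (if x > y then 1 else if x = y then \<alpha> else 0)"

definition payoffA :: "real \<Rightarrow> real \<Rightarrow> real \<Rightarrow> real \<Rightarrow> real \<Rightarrow> real \<Rightarrow> real" where
  "payoffA uA p q \<alpha> xA xB = uA * beta \<alpha> xA (q * xB - p) - xA"

definition payoffB :: "real \<Rightarrow> real \<Rightarrow> real \<Rightarrow> real \<Rightarrow> real \<Rightarrow> real \<Rightarrow> real" where
  "payoffB uB p q \<alpha> xA xB = uB * (1 - beta \<alpha> xA (q * xB - p)) - xB"

text \<open>Mixed strategies: Borel probability measures on the real line concentrated on the
  nonnegative reals.\<close>

definition mixed_strategy :: "real measure \<Rightarrow> bool" where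
  "mixed_strategy \<mu> \<longleftrightarrow> real_distribution \<mu> \<and> measure \<mu> {0..} = 1"

text \<open>Bid distributions with infinite mean are legitimate strategies and yield expected payoff
  minus infinity, whereas the Bochner integral of a non-integrable function is 0. Hence expectations
  are taken in the extended reals, as positive part minus negative part (\<^const>\<open>ennreal\<close>
  truncates negative reals to 0). The payoffs here are bounded above on nonnegative bids, so the
  positive part is always finite.\<close>

definition ext_expectation :: "'a measure \<Rightarrow> ('a \<Rightarrow> real) \<Rightarrow> ereal" where
  "ext_expectation M f =
     enn2ereal (\<integral>\<^sup>+ x. ennreal (f x) \<partial>M) - enn2ereal (\<integral>\<^sup>+ x. ennreal (- f x) \<partial>M)"

definition exp_payoffA ::
  "real \<Rightarrow> real \<Rightarrow> real \<Rightarrow> real \<Rightarrow> real measure \<Rightarrow> real measure \<Rightarrow> ereal" where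
  "exp_payoffA uA p q \<alpha> \<mu> \<nu> =
     ext_expectation (\<mu> \<Otimes>\<^sub>M \<nu>) (\<lambda>(xA, xB). payoffA uA p q \<alpha> xA xB)"

definition exp_payoffB ::
  "real \<Rightarrow> real \<Rightarrow> real \<Rightarrow> real \<Rightarrow> real measure \<Rightarrow> real measure \<Rightarrow> ereal" where
  "exp_payoffB uB p q \<alpha> \<mu> \<nu> =
     ext_expectation (\<mu> \<Otimes>\<^sub>M \<nu>) (\<lambda>(xA, xB). payoffB uB p q \<alpha> xA xB)"

definition equilibrium ::
  "real \<Rightarrow> real \<Rightarrow> real \<Rightarrow> real \<Rightarrow> real \<Rightarrow> real measure \<Rightarrow> real measure \<Rightarrow> bool" where
  "equilibrium uA uB p q \<alpha> \<mu> \<nu> \<longleftrightarrow>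
     mixed_strategy \<mu> \<and> mixed_strategy \<nu> \<and>
     (\<forall>\<mu>'. mixed_strategy \<mu>' \<longrightarrow> exp_payoffA uA p q \<alpha> \<mu>' \<nu> \<le> exp_payoffA uA p q \<alpha> \<mu> \<nu>) \<and>
     (\<forall>\<nu>'. mixed_strategy \<nu>' \<longrightarrow> exp_payoffB uB p q \<alpha> \<mu> \<nu>' \<le> exp_payoffB uB p q \<alpha> \<mu> \<nu>)"

text \<open>A deterministic bid is the corresponding point mass; deviations to arbitrary mixed
  strategies are allowed.\<close>

definition pure_equilibrium ::
  "real \<Rightarrow> real \<Rightarrow> real \<Rightarrow> real \<Rightarrow> real \<Rightarrow> real \<Rightarrow> real \<Rightarrow> bool" where
  "pure_equilibrium uA uB p q \<alpha> xA xB \<longleftrightarrow>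
     xA \<ge> 0 \<and> xB \<ge> 0 \<and> equilibrium uA uB p q \<alpha> (return borel xA) (return borel xB)"

text \<open>The cumulative distribution functions of the equilibrium bids for negative \<open>p\<close>, extended
  by 0 to the negative reals.\<close>

definition FA2 :: "real \<Rightarrow> real \<Rightarrow> real \<Rightarrow> real \<Rightarrow> real \<Rightarrow> real" where
  "FA2 uA uB p q x =
     (if x < 0 then 0
      else if x < - p then 1 - uA / (q * uB) - p / (q * uB)
      else if x \<le> uA then 1 - uA / (q * uB) + x / (q * uB)
      else 1)"

definition FB2 :: "real \<Rightarrow> real \<Rightarrow> real \<Rightarrow> real \<Rightarrow> real" where
  "FB2 uA p q x =
     (if x < 0 then 0
      else if x \<le> (uA + p) / q then - p / uA + q * x / uA
      else 1)"

definition FA3 :: "real \<Rightarrow> real \<Rightarrow> real \<Rightarrow> real \<Rightarrow> real" where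
  "FA3 uB p q x =
     (if x < - p then 0
      else if x \<le> q * uB - p then p / (q * uB) + x / (q * uB)
      else 1)"

definition FB3 :: "real \<Rightarrow> real \<Rightarrow> real \<Rightarrow> real \<Rightarrow> real" where
  "FB3 uA uB q x =
     (if x < 0 then 0
      else if x \<le> uB then 1 - q * uB / uA + q * x / uA
      else 1)"

end

(* By Fubini, a mixed strategy profile is an equilibrium with values V and W as soon as no pure
   deviation pays more than V (resp. W) and almost every bid in each player's support earns
   exactly that.  The mixed equilibria (ii) and (iii) are one family: put T = min uB ((uA + p) / q);
   Player B bids 0 with probability 1 - q T / uA and otherwise uniformly on (0, T], Player A bids 0
   with probability 1 - T / uB and otherwise uniformly on (-p, q T - p].  The values are
   uA - q T + p and uB - T.  In a pure equilibrium either a tie or an outright win by A leaves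
   someone a profitable deviation, so A loses and both bid 0, which is stable iff uA + p <= 0. *)
theory Submission
  imports Defs
begin

section \<open>Extended expectations over product measures\<close>

lemma ext_expectation_integrable:
  assumes "integrable M f"
  shows "ext_expectation M f = ereal (\<integral>x. f x \<partial>M)"
proof -
  have "(\<integral>\<^sup>+ x. ennreal (f x) \<partial>M) \<noteq> \<infinity>" "(\<integral>\<^sup>+ x. ennreal (- f x) \<partial>M) \<noteq> \<infinity>"
    using assms by (auto simp: real_integrable_def)
  then show ?thesis
    unfolding ext_expectation_def real_lebesgue_integral_def[OF assms]
    by (metis enn2real_nonneg ennreal_enn2real_if enn2ereal_ennreal ereal_minus(1) infinity_ennreal_def)
qed

text \<open>With a finite positive part, only an infinite negative part can destroy integrability,
  so the difference is minus infinity.\<close>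

lemma ext_expectation_not_integrable:
  assumes "f \<in> borel_measurable M" "\<not> integrable M f" "(\<integral>\<^sup>+ x. ennreal (f x) \<partial>M) < \<infinity>"
  shows "ext_expectation M f = -\<infinity>"
proof -
  have "(\<integral>\<^sup>+ x. ennreal (- f x) \<partial>M) = \<infinity>"
    using assms by (auto simp: real_integrable_def)
  moreover obtain r where "(\<integral>\<^sup>+ x. ennreal (f x) \<partial>M) = ennreal r" "0 \<le> r"
    using assms(3) by (cases "\<integral>\<^sup>+ x. ennreal (f x) \<partial>M") auto
  ultimately show ?thesis
    by (simp add: ext_expectation_def enn2ereal_ennreal)
qed

text \<open>Made for deviations, whose bids may have infinite mean. Fubini settles the integrable
  case; otherwise the upper bound \<open>c\<close> keeps the positive part finite, the expectation
  is minus infinity, and any \<open>V\<close> bounds it.\<close>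

lemma (in pair_prob_space) ext_expectation_pair_le:
  assumes [measurable]: "f \<in> borel_measurable (M1 \<Otimes>\<^sub>M M2)"
    and bound: "AE z in M1 \<Otimes>\<^sub>M M2. f z \<le> c"
    and le: "AE x in M1. (\<integral>y. f (x, y) \<partial>M2) \<le> V"
  shows "ext_expectation (M1 \<Otimes>\<^sub>M M2) f \<le> ereal V"
proof (cases "integrable (M1 \<Otimes>\<^sub>M M2) f")
  case True
  have "(\<integral>z. f z \<partial>(M1 \<Otimes>\<^sub>M M2)) = (\<integral>x. (\<integral>y. f (x, y) \<partial>M2) \<partial>M1)"
    using integral_fst'[OF True] by simp
  also have "\<dots> \<le> (\<integral>x. V \<partial>M1)"
    using integrable_fst'[OF True] le by (intro integral_mono_AE) auto
  finally show ?thesis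
    by (simp add: ext_expectation_integrable[OF True] M1.prob_space)
next
  case False
  have "(\<integral>\<^sup>+ z. ennreal (f z) \<partial>(M1 \<Otimes>\<^sub>M M2)) \<le> (\<integral>\<^sup>+ z. ennreal c \<partial>(M1 \<Otimes>\<^sub>M M2))"
    using bound by (intro nn_integral_mono_AE) (auto intro: ennreal_leI)
  also have "\<dots> < \<infinity>"
    by (simp add: P.emeasure_space_1)
  finally show ?thesis
    using False by (simp add: ext_expectation_not_integrable)
qed

text \<open>Made for the equilibrium profile itself: its bids are bounded, so the payoff is
  integrable and Fubini applies directly.\<close>

lemma (in pair_prob_space) ext_expectation_pair_eq:
  assumes [measurable]: "f \<in> borel_measurable (M1 \<Otimes>\<^sub>M M2)"
    and bound: "AE z in M1 \<Otimes>\<^sub>M M2. \<bar>f z\<bar> \<le> c"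
    and eq: "AE x in M1. (\<integral>y. f (x, y) \<partial>M2) = V"
  shows "ext_expectation (M1 \<Otimes>\<^sub>M M2) f = ereal V"
proof -
  have int: "integrable (M1 \<Otimes>\<^sub>M M2) f"
    using bound by (intro P.integrable_const_bound[of _ c]) auto
  have "(\<integral>z. f z \<partial>(M1 \<Otimes>\<^sub>M M2)) = (\<integral>x. (\<integral>y. f (x, y) \<partial>M2) \<partial>M1)"
    using integral_fst'[OF int] by simp
  also have "\<dots> = (\<integral>x. V \<partial>M1)"
    using integrable_fst'[OF int] eq by (intro integral_cong_AE) auto
  finally show ?thesis
    by (simp add: ext_expectation_integrable[OF int] M1.prob_space)
qed

text \<open>Makes Player B's bid the outer variable, so that the two preceding lemmas serve both
  players.\<close>

lemma (in pair_prob_space) ext_expectation_swap: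
  assumes [measurable]: "f \<in> borel_measurable (M1 \<Otimes>\<^sub>M M2)"
  shows "ext_expectation (M1 \<Otimes>\<^sub>M M2) f = ext_expectation (M2 \<Otimes>\<^sub>M M1) (\<lambda>(x, y). f (y, x))"
  unfolding ext_expectation_def
  by (subst (1 2) distr_pair_swap) (simp add: nn_integral_distr case_prod_beta')

text \<open>Carries a property of a player's own bid to the product measure, where the bounds on the
  payoff have to hold.\<close>

lemma AE_pair_fstI:
  assumes "prob_space M" "prob_space N" "{x \<in> space M. P x} \<in> sets M" "AE x in M. P x"
  shows "AE z in M \<Otimes>\<^sub>M N. P (fst z)"
proof -
  interpret M: prob_space M by fact
  interpret N: prob_space N by fact
  interpret pair_prob_space M N ..
  have [measurable]: "Measurable.pred M P"
    using assms(3) by (simp add: pred_def)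
  show ?thesis
    using assms(4) by (intro AE_pair_measure) auto
qed

section \<open>Payoffs: bounds, measurability, averages over the opponent's bid\<close>

lemma beta_bounds:
  assumes "0 \<le> \<alpha>" "\<alpha> \<le> 1"
  shows "0 \<le> beta \<alpha> x y" "beta \<alpha> x y \<le> 1"
  using assms by (auto simp: beta_def)

lemma beta_measurable [measurable]:
  assumes "f \<in> borel_measurable M" "g \<in> borel_measurable M"
  shows "(\<lambda>z. beta \<alpha> (f z) (g z)) \<in> borel_measurable M"
  unfolding beta_def using assms by measurable

lemma payoff_measurable [measurable]:
  assumes "f \<in> borel_measurable M" "g \<in> borel_measurable M"
  shows "(\<lambda>z. payoffA u p q \<alpha> (f z) (g z)) \<in> borel_measurable M"
    and "(\<lambda>z. payoffB u p q \<alpha> (f z) (g z)) \<in> borel_measurable M"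
  unfolding payoffA_def payoffB_def using assms by measurable

lemma payoff_bounds:
  assumes "0 \<le> \<alpha>" "\<alpha> \<le> 1" "0 < u"
  shows "- x \<le> payoffA u p q \<alpha> x y" "payoffA u p q \<alpha> x y \<le> u - x"
    "- y \<le> payoffB u p q \<alpha> x y" "payoffB u p q \<alpha> x y \<le> u - y"
  using assms beta_bounds[OF assms(1,2), of x "q * y - p"]
  by (auto simp: payoffA_def payoffB_def mult_left_le)

lemma AE_mixed_strategy_nonneg:
  assumes "mixed_strategy \<mu>"
  shows "AE x in \<mu>. 0 \<le> x"
proof -
  interpret real_distribution \<mu> using assms by (simp add: mixed_strategy_def)
  have "AE x in \<mu>. x \<in> {0..}"
    using assms by (intro AE_prob_1) (simp add: mixed_strategy_def)
  then show ?thesis by simp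
qed

text \<open>Solving \<open>x > q * y - p\<close> for \<open>y\<close> shows that Player A beats
  exactly the bids below \<open>(x + p) / q\<close> and ties only there. The payoff is thus a
  combination of two indicators, minus the bid.\<close>

lemma integral_payoffA:
  assumes "real_distribution \<nu>" "0 < q"
  shows "(\<integral>y. payoffA u p q \<alpha> x y \<partial>\<nu>) =
    u * (measure \<nu> {..<(x + p) / q} + \<alpha> * measure \<nu> {(x + p) / q}) - x"
proof -
  interpret real_distribution \<nu> by fact
  have "payoffA u p q \<alpha> x y =
    u * (indicator {..<(x + p) / q} y + \<alpha> * indicator {(x + p) / q} y) - x" for y
    using \<open>0 < q\<close> by (auto simp: payoffA_def beta_def field_simps split: split_indicator)
  then show ?thesis
    using prob_space by (simp add: integrable_real_indicator emeasure_eq_measure)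
qed

lemma integral_payoffB:
  assumes "real_distribution \<mu>"
  shows "(\<integral>x. payoffB u p q \<alpha> x y \<partial>\<mu>) =
    u * (measure \<mu> {..<q * y - p} + (1 - \<alpha>) * measure \<mu> {q * y - p}) - y"
proof -
  interpret real_distribution \<mu> by fact
  have "payoffB u p q \<alpha> x y =
    u * (indicator {..<q * y - p} x + (1 - \<alpha>) * indicator {q * y - p} x) - y" for x
    by (auto simp: payoffB_def beta_def split: split_indicator)
  then show ?thesis
    using prob_space by (simp add: integrable_real_indicator emeasure_eq_measure)
qed

section \<open>From payoffs of single bids to payoffs of mixed profiles\<close>

context
  fixes \<mu> \<nu> :: "real measure" and u p q \<alpha> :: real
  assumes strategies: "mixed_strategy \<mu>" "mixed_strategy \<nu>"
    and params: "0 < u" "0 \<le> \<alpha>" "\<alpha> \<le> 1"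
begin

interpretation M: real_distribution \<mu>
  using strategies by (simp add: mixed_strategy_def)
interpretation N: real_distribution \<nu>
  using strategies by (simp add: mixed_strategy_def)
interpretation MN: pair_prob_space \<mu> \<nu> ..
interpretation NM: pair_prob_space \<nu> \<mu> ..

lemma exp_payoffB_swap:
  "exp_payoffB u p q \<alpha> \<mu> \<nu> =
    ext_expectation (\<nu> \<Otimes>\<^sub>M \<mu>) (\<lambda>z. payoffB u p q \<alpha> (snd z) (fst z))"
  unfolding exp_payoffB_def by (subst MN.ext_expectation_swap) (simp_all add: case_prod_beta')

lemma exp_payoffA_le:
  assumes "\<And>x. 0 \<le> x \<Longrightarrow> (\<integral>y. payoffA u p q \<alpha> x y \<partial>\<nu>) \<le> V"
  shows "exp_payoffA u p q \<alpha> \<mu> \<nu> \<le> ereal V"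
  unfolding exp_payoffA_def
\<comment> \<open>The own bid is almost surely nonnegative and only lowers the payoff, so
  \<open>u\<close> is an upper bound.\<close>
proof (rule MN.ext_expectation_pair_le[where c = u])
  have "AE z in \<mu> \<Otimes>\<^sub>M \<nu>. 0 \<le> fst z"
    using AE_mixed_strategy_nonneg[OF strategies(1)]
    by (intro AE_pair_fstI) (auto intro: M.prob_space_axioms N.prob_space_axioms)
  then show "AE z in \<mu> \<Otimes>\<^sub>M \<nu>. (case z of (xA, xB) \<Rightarrow> payoffA u p q \<alpha> xA xB) \<le> u"
  proof eventually_elim
    case (elim z)
    then show ?case
      using payoff_bounds(2)[OF params(2,3,1), of p q "fst z" "snd z"] by (auto simp: case_prod_beta')
  qed
  show "AE x in \<mu>. (\<integral>y. (case (x, y) of (xA, xB) \<Rightarrow> payoffA u p q \<alpha> xA xB) \<partial>\<nu>) \<le> V"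
    using AE_mixed_strategy_nonneg[OF strategies(1)] by eventually_elim (simp add: assms)
qed measurable

lemma exp_payoffB_le:
  assumes "\<And>y. 0 \<le> y \<Longrightarrow> (\<integral>x. payoffB u p q \<alpha> x y \<partial>\<mu>) \<le> V"
  shows "exp_payoffB u p q \<alpha> \<mu> \<nu> \<le> ereal V"
  unfolding exp_payoffB_swap
proof (rule NM.ext_expectation_pair_le[where c = u])
  have "AE z in \<nu> \<Otimes>\<^sub>M \<mu>. 0 \<le> fst z"
    using AE_mixed_strategy_nonneg[OF strategies(2)]
    by (intro AE_pair_fstI) (auto intro: M.prob_space_axioms N.prob_space_axioms)
  then show "AE z in \<nu> \<Otimes>\<^sub>M \<mu>. payoffB u p q \<alpha> (snd z) (fst z) \<le> u"
  proof eventually_elim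
    case (elim z)
    then show ?case
      using payoff_bounds(4)[OF params(2,3,1), of p q "snd z" "fst z"] by auto
  qed
  show "AE y in \<nu>. (\<integral>x. payoffB u p q \<alpha> (snd (y, x)) (fst (y, x)) \<partial>\<mu>) \<le> V"
    using AE_mixed_strategy_nonneg[OF strategies(2)] by eventually_elim (simp add: assms)
qed measurable

lemma exp_payoffA_eq:
  assumes "AE x in \<mu>. x \<in> {0..K} \<and> (\<integral>y. payoffA u p q \<alpha> x y \<partial>\<nu>) = V"
  shows "exp_payoffA u p q \<alpha> \<mu> \<nu> = ereal V"
  unfolding exp_payoffA_def
\<comment> \<open>Own bids in \<open>{0..K}\<close> put the payoff between \<open>- K\<close> and
  \<open>u\<close>.\<close>
proof (rule MN.ext_expectation_pair_eq[where c = "u + K"])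
  have "AE z in \<mu> \<Otimes>\<^sub>M \<nu>. fst z \<in> {0..K}"
    using assms
    by (intro AE_pair_fstI[where P = "\<lambda>x. x \<in> {0..K}"])
      (auto intro: M.prob_space_axioms N.prob_space_axioms elim: eventually_mono)
  then show "AE z in \<mu> \<Otimes>\<^sub>M \<nu>. \<bar>case z of (xA, xB) \<Rightarrow> payoffA u p q \<alpha> xA xB\<bar> \<le> u + K"
  proof eventually_elim
    case (elim z)
    then show ?case
      using payoff_bounds(1,2)[OF params(2,3,1), where p = p and q = q and x = "fst z" and y = "snd z"] params(1)
      by (auto simp: case_prod_beta' abs_le_iff)
  qed
  show "AE x in \<mu>. (\<integral>y. (case (x, y) of (xA, xB) \<Rightarrow> payoffA u p q \<alpha> xA xB) \<partial>\<nu>) = V"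
    using assms by eventually_elim simp
qed measurable

lemma exp_payoffB_eq:
  assumes "AE y in \<nu>. y \<in> {0..K} \<and> (\<integral>x. payoffB u p q \<alpha> x y \<partial>\<mu>) = V"
  shows "exp_payoffB u p q \<alpha> \<mu> \<nu> = ereal V"
  unfolding exp_payoffB_swap
proof (rule NM.ext_expectation_pair_eq[where c = "u + K"])
  have "AE z in \<nu> \<Otimes>\<^sub>M \<mu>. fst z \<in> {0..K}"
    using assms
    by (intro AE_pair_fstI[where P = "\<lambda>y. y \<in> {0..K}"])
      (auto intro: M.prob_space_axioms N.prob_space_axioms elim: eventually_mono)
  then show "AE z in \<nu> \<Otimes>\<^sub>M \<mu>. \<bar>payoffB u p q \<alpha> (snd z) (fst z)\<bar> \<le> u + K"
  proof eventually_elim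
    case (elim z)
    then show ?case
      using payoff_bounds(3,4)[OF params(2,3,1), where p = p and q = q and x = "snd z" and y = "fst z"] params(1)
      by (auto simp: abs_le_iff)
  qed
  show "AE y in \<nu>. (\<integral>x. payoffB u p q \<alpha> (snd (y, x)) (fst (y, x)) \<partial>\<mu>) = V"
    using assms by eventually_elim simp
qed measurable

end

text \<open>The bounds \<open>K\<close> and \<open>L\<close> on the equilibrium bids make the values
  finite integrals; deviations are subject to no such bound.\<close>

lemma equilibriumI:
  assumes "mixed_strategy \<mu>" "mixed_strategy \<nu>"
    and "0 < uA" "0 < uB" "0 \<le> \<alpha>" "\<alpha> \<le> 1"
    and "\<And>x. 0 \<le> x \<Longrightarrow> (\<integral>y. payoffA uA p q \<alpha> x y \<partial>\<nu>) \<le> V"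
    and "\<And>y. 0 \<le> y \<Longrightarrow> (\<integral>x. payoffB uB p q \<alpha> x y \<partial>\<mu>) \<le> W"
    and "AE x in \<mu>. x \<in> {0..K} \<and> (\<integral>y. payoffA uA p q \<alpha> x y \<partial>\<nu>) = V"
    and "AE y in \<nu>. y \<in> {0..L} \<and> (\<integral>x. payoffB uB p q \<alpha> x y \<partial>\<mu>) = W"
  shows "equilibrium uA uB p q \<alpha> \<mu> \<nu>" "exp_payoffA uA p q \<alpha> \<mu> \<nu> = ereal V"
    "exp_payoffB uB p q \<alpha> \<mu> \<nu> = ereal W"
proof -
  show A: "exp_payoffA uA p q \<alpha> \<mu> \<nu> = ereal V" and B: "exp_payoffB uB p q \<alpha> \<mu> \<nu> = ereal W"
    using assms by (blast intro: exp_payoffA_eq exp_payoffB_eq)+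
  show "equilibrium uA uB p q \<alpha> \<mu> \<nu>"
    unfolding equilibrium_def A B using assms by (auto intro: exp_payoffA_le exp_payoffB_le)
qed

section \<open>Point masses and pure equilibria\<close>

lemma mixed_strategy_return:
  assumes "0 \<le> x"
  shows "mixed_strategy (return borel x)"
proof -
  interpret prob_space "return borel x" by (rule prob_space_return) simp
  show ?thesis
    unfolding mixed_strategy_def using assms
    by (auto intro!: real_distribution.intro prob_space_axioms real_distribution_axioms.intro
        simp: measure_return)
qed

lemma exp_payoff_return:
  assumes "0 \<le> x" "0 \<le> y" "0 < u" "0 \<le> \<alpha>" "\<alpha> \<le> 1"
  shows "exp_payoffA u p q \<alpha> (return borel x) (return borel y) = ereal (payoffA u p q \<alpha> x y)"
    "exp_payoffB u p q \<alpha> (return borel x) (return borel y) = ereal (payoffB u p q \<alpha> x y)"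
  using assms
  by (auto intro!: exp_payoffA_eq[where K = x] exp_payoffB_eq[where K = y] mixed_strategy_return
      simp: integral_return AE_return)

text \<open>Testing an equilibrium against point masses alone already gives inequalities between
  plain payoffs, which suffice to refute a candidate.\<close>

lemma pure_equilibrium_best_response:
  assumes "pure_equilibrium uA uB p q \<alpha> xA xB" "0 < uA" "0 < uB" "0 \<le> \<alpha>" "\<alpha> \<le> 1" "0 \<le> z"
  shows "payoffA uA p q \<alpha> z xB \<le> payoffA uA p q \<alpha> xA xB"
    "payoffB uB p q \<alpha> xA z \<le> payoffB uB p q \<alpha> xA xB"
  using assms mixed_strategy_return[of z]
  by (auto simp: pure_equilibrium_def equilibrium_def exp_payoff_return
      simp flip: ereal_less_eq(3))

lemma pure_equilibrium_imp_zero: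
  assumes eq: "pure_equilibrium uA uB p q \<alpha> xA xB"
    and params: "0 < uA" "0 < uB" "0 \<le> \<alpha>" "\<alpha> \<le> 1" and "0 < q" "p < 0"
  shows "xA = 0" "xB = 0"
proof -
  note A = pure_equilibrium_best_response(1)[OF eq params]
  note B = pure_equilibrium_best_response(2)[OF eq params]
  have nonneg: "0 \<le> xA" "0 \<le> xB"
    using eq by (auto simp: pure_equilibrium_def)
  \<comment> \<open>\<open>t\<close> is the bid at which Player A ties with \<open>xB\<close>; it is
    positive because \<open>p < 0\<close>.\<close>
  define t where "t = q * xB - p"
  have t: "0 < t"
    using \<open>0 < q\<close> \<open>p < 0\<close> nonneg by (simp add: t_def add_nonneg_pos diff_less_eq less_le_trans)
  \<comment> \<open>After an outright win of A, the midpoint of \<open>xA\<close> and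
    \<open>t\<close> would still win and cost less.\<close>
  have "\<not> t < xA"
    using A[of "(xA + t) / 2"] t by (auto simp: payoffA_def beta_def t_def[symmetric])
  moreover have "xA \<noteq> t"
  proof
    assume "xA = t"
    show False
    proof (cases "\<alpha> < 1")
      case True
      \<comment> \<open>A sure win instead of the tie is worth \<open>d\<close> to Player A, so
        overbidding by \<open>d / 2\<close> leaves a gain of \<open>d / 2\<close>.\<close>
      define d where "d = uA * (1 - \<alpha>)"
      have "0 < d" "uA * \<alpha> = uA - d"
        using True \<open>0 < uA\<close> by (simp_all add: d_def algebra_simps)
      then show False
        using A[of "t + d / 2"] t \<open>xA = t\<close>
        by (auto simp: payoffA_def beta_def t_def[symmetric])
    next
      case False
      \<comment> \<open>Here \<alpha> = 1, so Player B loses the tie; raising the bid by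
        \<open>uB / 2\<close> wins an item worth \<open>uB\<close>.\<close>
      have "\<not> q * (xB + uB / 2) - p \<le> t"
        using mult_pos_pos[OF \<open>0 < q\<close> \<open>0 < uB\<close>] by (simp add: t_def algebra_simps)
      then show False
        using B[of "xB + uB / 2"] False \<open>\<alpha> \<le> 1\<close> \<open>xA = t\<close> nonneg \<open>0 < uB\<close>
        by (auto simp: payoffB_def beta_def t_def[symmetric])
    qed
  qed
  ultimately have "xA < t"
    by simp
  \<comment> \<open>Player A loses, and since \<open>0 < t\<close> the bid 0 loses too, but for
    free.\<close>
  then show "xA = 0"
    using A[of 0] t nonneg by (auto simp: payoffA_def beta_def t_def[symmetric])
  \<comment> \<open>Against \<open>xA = 0\<close> Player B wins even with bid 0, because
    \<open>0 < - p\<close>.\<close>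
  then show "xB = 0"
    using B[of 0] t nonneg \<open>p < 0\<close> by (auto simp: payoffB_def beta_def t_def[symmetric])
qed

lemma no_pure_equilibrium:
  assumes params: "0 < uA" "0 < uB" "0 \<le> \<alpha>" "\<alpha> \<le> 1" and "0 < q" "p < 0" "0 < uA + p"
  shows "\<not> pure_equilibrium uA uB p q \<alpha> xA xB"
proof
  assume eq: "pure_equilibrium uA uB p q \<alpha> xA xB"
  with assms have "xA = 0" "xB = 0"
    by (auto dest: pure_equilibrium_imp_zero)
  \<comment> \<open>The deviation is the midpoint of \<open>- p\<close> and \<open>uA\<close>: it
    beats B's bid 0 and costs less than the item is worth to A.\<close>
  then show False
    using pure_equilibrium_best_response(1)[OF eq params, of "(uA - p) / 2"] assms
    by (auto simp: payoffA_def beta_def)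
qed

lemma pure_equilibrium_zero:
  assumes "0 < uA" "0 < uB" "0 \<le> \<alpha>" "\<alpha> \<le> 1" "0 < q" "p < 0" "uA + p \<le> 0"
  shows "pure_equilibrium uA uB p q \<alpha> 0 0"
proof -
  \<comment> \<open>Matching or beating B's bid 0 takes a bid of at least \<open>- p\<close>, which
    is no less than \<open>uA\<close>; so neither a tie nor a win pays for A.\<close>
  have tie: "uA * \<alpha> \<le> - p"
    using assms mult_left_le[of \<alpha> uA] by linarith
  have "payoffA uA p q \<alpha> x 0 \<le> 0" if "0 \<le> x" for x
    using that tie assms by (cases "x = - p") (auto simp: payoffA_def beta_def)
  moreover have "payoffB uB p q \<alpha> 0 y \<le> uB" if "0 \<le> y" for y
    using that payoff_bounds(4)[OF \<open>0 \<le> \<alpha>\<close> \<open>\<alpha> \<le> 1\<close> \<open>0 < uB\<close>, of p q 0 y] by simp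
  ultimately have "equilibrium uA uB p q \<alpha> (return borel 0) (return borel 0)"
    using assms tie
    by (intro equilibriumI(1)[where V = 0 and W = uB and K = 0 and L = 0] mixed_strategy_return)
      (auto simp: integral_return AE_return payoffA_def payoffB_def beta_def)
  then show ?thesis
    by (simp add: pure_equilibrium_def)
qed

section \<open>Distributions with an atom at 0 and a uniform part\<close>

definition atom_uniform_cdf :: "real \<Rightarrow> real \<Rightarrow> real \<Rightarrow> real \<Rightarrow> real" where
  "atom_uniform_cdf w a b x =
     (if x < 0 then 0 else w + (1 - w) * max 0 (min 1 ((x - a) / (b - a))))"

text \<open>Mass \<open>w\<close> sits at 0 and mass \<open>1 - w\<close> is uniform on
  \<open>{a<..b}\<close>. Clamping the linear part makes the distribution function continuous on the
  nonnegative reals. Player B's bids have \<open>a = 0\<close>, Player A's have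
  \<open>a = - p\<close>.\<close>

locale atom_uniform =
  fixes w a b :: real
  assumes w: "0 \<le> w" "w \<le> 1" and ab: "0 \<le> a" "a < b"
begin

definition dist :: "real measure" where
  "dist = interval_measure (atom_uniform_cdf w a b)"

lemma atom_uniform_cdf_mono: "x \<le> y \<Longrightarrow> atom_uniform_cdf w a b x \<le> atom_uniform_cdf w a b y"
proof -
  assume "x \<le> y"
  then have "(x - a) / (b - a) \<le> (y - a) / (b - a)"
    using ab by (simp add: divide_right_mono)
  then have "(1 - w) * max 0 (min 1 ((x - a) / (b - a)))
      \<le> (1 - w) * max 0 (min 1 ((y - a) / (b - a)))"
    using w by (intro mult_left_mono) auto
  then show ?thesis
    using w \<open>x \<le> y\<close> by (auto simp: atom_uniform_cdf_def)
qed

text \<open>From 0 on the function agrees with the continuous \<open>?G\<close>. The point 0 itself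
  falls to this branch, since the test for the zero branch is strict.\<close>

lemma atom_uniform_cdf_right_cont: "continuous (at_right x) (atom_uniform_cdf w a b)"
proof (cases "x < 0")
  case True
  then have "eventually (\<lambda>y. y < 0) (at_right x)"
    by (auto simp: eventually_at_right_field)
  then have "eventually (\<lambda>y. atom_uniform_cdf w a b y = 0) (at_right x)"
    by eventually_elim (simp add: atom_uniform_cdf_def)
  then show ?thesis
    using True by (simp add: continuous_within atom_uniform_cdf_def tendsto_eventually)
next
  case False
  let ?G = "\<lambda>y. w + (1 - w) * max 0 (min 1 ((y - a) / (b - a)))"
  have "(?G \<longlongrightarrow> ?G x) (at_right x)"
    using ab by (intro tendsto_intros) auto
  moreover have "eventually (\<lambda>y. atom_uniform_cdf w a b y = ?G y) (at_right x)"
    using eventually_at_right_less[of x] False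
    by (auto elim!: eventually_mono simp: atom_uniform_cdf_def)
  ultimately show ?thesis
    using False by (simp add: continuous_within atom_uniform_cdf_def tendsto_cong)
qed

lemma atom_uniform_cdf_at_bot: "(atom_uniform_cdf w a b \<longlongrightarrow> 0) at_bot"
  by (intro tendsto_eventually eventually_mono[OF eventually_gt_at_bot[of "0::real"]])
    (simp add: atom_uniform_cdf_def)

lemma atom_uniform_cdf_eq_1: "b \<le> x \<Longrightarrow> atom_uniform_cdf w a b x = 1"
  using ab by (auto simp: atom_uniform_cdf_def)

lemma atom_uniform_cdf_at_top: "(atom_uniform_cdf w a b \<longlongrightarrow> 1) at_top"
  by (intro tendsto_eventually eventually_mono[OF eventually_ge_at_top[of b]])
    (rule atom_uniform_cdf_eq_1)

sublocale real_distribution dist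
  unfolding dist_def
  by (intro real_distribution_interval_measure atom_uniform_cdf_mono atom_uniform_cdf_right_cont
      atom_uniform_cdf_at_bot atom_uniform_cdf_at_top)

lemma cdf_dist: "cdf dist = atom_uniform_cdf w a b"
  unfolding dist_def
  by (intro cdf_interval_measure atom_uniform_cdf_mono atom_uniform_cdf_right_cont
      atom_uniform_cdf_at_bot)

text \<open>The mass strictly below \<open>x\<close> is the left limit of the distribution function,
  which can differ from its value only at the jump at 0.\<close>

lemma measure_lessThan:
  "measure dist {..<x} = (if x \<le> 0 then 0 else atom_uniform_cdf w a b x)"
proof -
  let ?G = "\<lambda>y. w + (1 - w) * max 0 (min 1 ((y - a) / (b - a)))"
  have "(atom_uniform_cdf w a b \<longlongrightarrow> (if x \<le> 0 then 0 else atom_uniform_cdf w a b x)) (at_left x)"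
  proof (cases "x \<le> 0")
    case True
    then have "eventually (\<lambda>y. atom_uniform_cdf w a b y = 0) (at_left x)"
      by (auto simp: eventually_at_left_field atom_uniform_cdf_def intro!: exI[of _ "x - 1"])
    then show ?thesis
      using True by (simp add: tendsto_eventually)
  next
    case False
    then have "eventually (\<lambda>y. atom_uniform_cdf w a b y = ?G y) (at_left x)"
      by (auto simp: eventually_at_left_field atom_uniform_cdf_def intro!: exI[of _ 0])
    moreover have "(?G \<longlongrightarrow> ?G x) (at_left x)"
      using ab by (intro tendsto_intros) auto
    ultimately show ?thesis
      using False by (simp add: atom_uniform_cdf_def tendsto_cong)
  qed
  with cdf_at_left[of x] show ?thesis
    by (simp add: cdf_dist tendsto_unique[OF trivial_limit_at_left_real])
qed

lemma measure_singleton: "measure dist {x} = (if x = 0 then w else 0)"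
proof -
  have "measure dist {..x} = measure dist {..<x} + measure dist {x}"
    by (subst finite_measure_Union[symmetric]) (auto intro!: arg_cong[where f = "measure dist"])
  moreover have "atom_uniform_cdf w a b 0 = w"
    using ab by (simp add: atom_uniform_cdf_def max_absorb1 min_le_iff_disj)
  ultimately show ?thesis
    using cdf_dist[THEN fun_cong, of x]
    by (auto simp: cdf_def measure_lessThan atom_uniform_cdf_def split: if_splits)
qed

text \<open>The condition \<open>0 < w\<close> excludes 0 when it carries no mass: Player A's bid 0
  may then earn less than her equilibrium value.\<close>

lemma AE_support: "AE x in dist. (x = 0 \<and> 0 < w) \<or> (a < x \<and> x \<le> b)"
proof -
  have "measure dist ({0} \<union> {a<..b}) = measure dist {0} + measure dist {a<..b}"
    using ab by (intro finite_measure_Union) auto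
  also have "measure dist {a<..b} = 1 - w"
    using ab by (simp flip: cdf_diff_eq add: cdf_dist atom_uniform_cdf_def)
  finally have "measure dist ({0} \<union> {a<..b}) = 1"
    by (simp add: measure_singleton)
  then have "AE x in dist. x \<in> {0} \<union> {a<..b}"
    by (intro AE_prob_1)
  moreover have "AE x in dist. x = 0 \<longrightarrow> 0 < w"
  proof (cases "w = 0")
    case True
    then have "measure dist {0} = 0"
      by (metis measure_singleton)
    then have "AE x in dist. x \<notin> {0}"
      by (intro prob_eq_0[THEN iffD1]) auto
    then show ?thesis by eventually_elim simp
  qed (use w in simp)
  ultimately show ?thesis
    by eventually_elim auto
qed

lemma mixed_strategy_dist: "mixed_strategy dist"
proof -
  have "AE x in dist. x \<in> {0..}"
    using AE_support by eventually_elim (use ab in auto)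
  then have "measure dist {0..} = 1"
    by (intro prob_eq_1[THEN iffD2]) auto
  then show ?thesis
    using real_distribution_axioms by (simp add: mixed_strategy_def)
qed

end

section \<open>The family of mixed equilibria indexed by \<open>T\<close>\<close>

lemma mixed_equilibrium:
  fixes T :: real
  assumes params: "0 < uA" "0 < uB" "0 \<le> \<alpha>" "\<alpha> \<le> 1" and "0 < q" "p < 0"
    and T: "0 < T" "T \<le> uB" "q * T \<le> uA + p" "T = uB \<or> q * T = uA + p"
  obtains \<mu> \<nu> where "cdf \<mu> = atom_uniform_cdf (1 - T / uB) (- p) (q * T - p)"
    "cdf \<nu> = atom_uniform_cdf (1 - q * T / uA) 0 T"
    "equilibrium uA uB p q \<alpha> \<mu> \<nu>"
    "exp_payoffA uA p q \<alpha> \<mu> \<nu> = ereal (uA - q * T + p)"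
    "exp_payoffB uB p q \<alpha> \<mu> \<nu> = ereal (uB - T)"
proof -
  have qT: "0 < q * T" using \<open>0 < q\<close> T by simp
  \<comment> \<open>\<open>T \<le> uB\<close> keeps A's atom nonnegative;
    \<open>q * T \<le> uA + p < uA\<close> does the same for B's.\<close>
  interpret A: atom_uniform "1 - T / uB" "- p" "q * T - p"
    using params qT T \<open>p < 0\<close> by unfold_locales (auto simp: field_simps)
  interpret B: atom_uniform "1 - q * T / uA" 0 T
    using params qT T \<open>p < 0\<close> by unfold_locales (auto simp: field_simps)
  define EA where "EA x = (\<integral>y. payoffA uA p q \<alpha> x y \<partial>B.dist)" for x
  define EB where "EB y = (\<integral>x. payoffB uB p q \<alpha> x y \<partial>A.dist)" for y
  \<comment> \<open>Every bid of B beats A's atom, because \<open>q * y - p > 0\<close>, and ties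
    have probability 0. The result is constant on \<open>{0..T}\<close> and falls beyond
    \<open>T\<close>.\<close>
  have EB: "EB y = uB - T + min T y - y" if "0 \<le> y" for y
  proof -
    have pos: "0 < q * y - p"
      using that \<open>0 < q\<close> \<open>p < 0\<close> by (simp add: add_nonneg_pos diff_less_eq less_le_trans)
    have "max 0 (min 1 ((q * y - p - - p) / (q * T - p - - p))) = min T y / T"
      using that T \<open>0 < q\<close> by (auto simp: min_def max_def field_simps)
    then have "EB y = uB * (1 - T / uB + T / uB * (min T y / T)) - y"
      using pos by (simp add: EB_def integral_payoffB[OF A.real_distribution_axioms]
          A.measure_lessThan A.measure_singleton atom_uniform_cdf_def)
    also have "\<dots> = uB - T + min T y - y"
      using T params by (simp add: field_simps)
    finally show ?thesis .
  qed
  \<comment> \<open>Above \<open>- p\<close> Player A beats B's atom at 0 and again ties with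
    probability 0; below \<open>- p\<close> she loses to every bid.\<close>
  have EA_gt: "EA x = uA - q * T + min (q * T) (x + p) - x" if "- p < x" for x
  proof -
    have pos: "0 < (x + p) / q"
      using that \<open>0 < q\<close> by simp
    have "max 0 (min 1 (((x + p) / q - 0) / (T - 0))) = min (q * T) (x + p) / (q * T)"
      using that T \<open>0 < q\<close> by (auto simp: min_def max_def field_simps)
    with pos have "EA x = uA * (1 - q * T / uA + q * T / uA * (min (q * T) (x + p) / (q * T))) - x"
      using pos less_imp_neq[OF pos] by (simp del: zero_less_divide_iff divide_eq_0_iff
          add: EA_def integral_payoffA[OF B.real_distribution_axioms \<open>0 < q\<close>]
          B.measure_lessThan B.measure_singleton atom_uniform_cdf_def)
    also have "\<dots> = uA - q * T + min (q * T) (x + p) - x"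
      using T params \<open>0 < q\<close> by (simp add: field_simps)
    finally show ?thesis .
  qed
  have EA_lt: "EA x = - x" if "x < - p" for x
    using that \<open>0 < q\<close>
    by (simp add: EA_def integral_payoffA[OF B.real_distribution_axioms \<open>0 < q\<close>]
        B.measure_lessThan B.measure_singleton divide_le_0_iff)
  \<comment> \<open>At \<open>- p\<close> Player A ties with B's atom, the only place where \<alpha>
    enters. Since \<open>uA - q * T \<ge> - p > 0\<close>, replacing \<alpha> by 1 gives an upper
    bound.\<close>
  have "EA (- p) = uA * (\<alpha> * (1 - q * T / uA)) + p"
    by (simp add: EA_def integral_payoffA[OF B.real_distribution_axioms \<open>0 < q\<close>]
        B.measure_lessThan B.measure_singleton)
  also have "\<dots> = \<alpha> * (uA - q * T) + p"
    using params by (simp add: field_simps)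
  also have "\<dots> \<le> uA - q * T + p"
    using params T \<open>p < 0\<close> by (simp add: mult_left_le_one_le)
  finally have EA_le: "EA x \<le> uA - q * T + p" if "0 \<le> x" for x
    using that EA_gt[of x] EA_lt[of x] T by (cases x "- p" rule: linorder_cases) auto
  have AE_A: "AE x in A.dist. x \<in> {0..q * T - p} \<and> EA x = uA - q * T + p"
    using A.AE_support
  proof eventually_elim
    case (elim x)
    then show ?case
    proof
      text \<open>An atom at 0 requires \<open>T < uB\<close>, hence \<open>q * T = uA + p\<close> and Player A's value is 0.\<close>
      assume "x = 0 \<and> 0 < 1 - T / uB"
      then show ?case
        using T params qT \<open>p < 0\<close> EA_lt[of 0] by auto
    next
      assume "- p < x \<and> x \<le> q * T - p"
      then show ?case
        using \<open>p < 0\<close> EA_gt[of x] by auto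
    qed
  qed
  have AE_B: "AE y in B.dist. y \<in> {0..T} \<and> EB y = uB - T"
    using B.AE_support by eventually_elim (use T EB in auto)
  have EB_le: "EB y \<le> uB - T" if "0 \<le> y" for y
    using EB[OF that] by simp
  note equilibriumI[OF A.mixed_strategy_dist B.mixed_strategy_dist params
      EA_le[unfolded EA_def] EB_le[unfolded EB_def] AE_A[unfolded EA_def] AE_B[unfolded EB_def]]
  with A.cdf_dist B.cdf_dist show ?thesis
    by (intro that)
qed

section \<open>The stated distribution functions as members of the family\<close>

lemma atom_uniform_cdf_eq:
  assumes "0 \<le> a" "a < b" "1 - w = d * (b - a)"
  shows "atom_uniform_cdf w a b x =
    (if x < 0 then 0 else if x < a then w else if x \<le> b then w + d * (x - a) else 1)"
proof -
  have "max 0 (min 1 ((x - a) / (b - a))) =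
      (if x < a then 0 else if x \<le> b then (x - a) / (b - a) else 1)"
    using assms by (auto simp: field_simps)
  then show ?thesis
    using assms by (simp add: atom_uniform_cdf_def)
qed

lemma FA2_eq_atom_uniform_cdf:
  assumes "0 < uB" "0 < q" "p < 0" "0 < uA + p"
  shows "FA2 uA uB p q = atom_uniform_cdf (1 - (uA + p) / q / uB) (- p) uA"
proof
  fix x
  \<comment> \<open>\<open>d\<close> is the density of the uniform part: mass
    \<open>(uA + p) / (q * uB)\<close> over length \<open>uA + p\<close>.\<close>
  show "FA2 uA uB p q x = atom_uniform_cdf (1 - (uA + p) / q / uB) (- p) uA x"
    using assms by (subst atom_uniform_cdf_eq[where d = "1 / (q * uB)"])
      (auto simp: FA2_def field_simps)
qed

lemma FB2_eq_atom_uniform_cdf: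
  assumes "0 < uA" "0 < q" "0 < uA + p"
  shows "FB2 uA p q = atom_uniform_cdf (- p / uA) 0 ((uA + p) / q)"
proof
  fix x
  show "FB2 uA p q x = atom_uniform_cdf (- p / uA) 0 ((uA + p) / q) x"
    using assms by (subst atom_uniform_cdf_eq[where d = "q / uA"])
      (auto simp: FB2_def field_simps)
qed

text \<open>Without an atom the value is 0 all the way up to \<open>- p\<close>, so no separate
  branch for negative \<open>x\<close> is needed.\<close>

lemma FA3_eq_atom_uniform_cdf:
  assumes "0 < uB" "0 < q" "p < 0"
  shows "FA3 uB p q = atom_uniform_cdf 0 (- p) (q * uB - p)"
proof
  fix x
  show "FA3 uB p q x = atom_uniform_cdf 0 (- p) (q * uB - p) x"
    using assms by (subst atom_uniform_cdf_eq[where d = "1 / (q * uB)"])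
      (auto simp: FA3_def field_simps)
qed

lemma FB3_eq_atom_uniform_cdf:
  assumes "0 < uB" "0 < uA"
  shows "FB3 uA uB q = atom_uniform_cdf (1 - q * uB / uA) 0 uB"
proof
  fix x
  show "FB3 uA uB q x = atom_uniform_cdf (1 - q * uB / uA) 0 uB x"
    using assms by (subst atom_uniform_cdf_eq[where d = "q / uA"])
      (auto simp: FB3_def field_simps)
qed

theorem theoremA3:
  fixes uA uB p q \<alpha> :: real
  assumes "uA > 0" and "uB > 0" and "q > 0" and "p < 0" and "0 \<le> \<alpha>" and "\<alpha> \<le> 1"
  shows
    "((uA + p) / q \<le> 0 \<longrightarrow>
        (\<exists>!(xA, xB). pure_equilibrium uA uB p q \<alpha> xA xB) \<and>
        (\<forall>xA xB. pure_equilibrium uA uB p q \<alpha> xA xB \<longrightarrow>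
           xA = 0 \<and> xB = 0 \<and>
           exp_payoffA uA p q \<alpha> (return borel xA) (return borel xB) = 0 \<and>
           exp_payoffB uB p q \<alpha> (return borel xA) (return borel xB) = ereal uB))
     \<and>
     (0 < (uA + p) / q \<and> (uA + p) / q \<le> uB \<longrightarrow>
        (\<nexists>xA xB. pure_equilibrium uA uB p q \<alpha> xA xB) \<and>
        (\<exists>\<mu> \<nu>. cdf \<mu> = FA2 uA uB p q \<and> cdf \<nu> = FB2 uA p q \<and>
           equilibrium uA uB p q \<alpha> \<mu> \<nu> \<and>
           exp_payoffA uA p q \<alpha> \<mu> \<nu> = 0 \<and>
           exp_payoffB uB p q \<alpha> \<mu> \<nu> = ereal (uB - (uA + p) / q)))
     \<and>
     ((uA + p) / q > uB \<longrightarrow>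
        (\<nexists>xA xB. pure_equilibrium uA uB p q \<alpha> xA xB) \<and>
        (\<exists>\<mu> \<nu>. cdf \<mu> = FA3 uB p q \<and> cdf \<nu> = FB3 uA uB q \<and>
           equilibrium uA uB p q \<alpha> \<mu> \<nu> \<and>
           exp_payoffA uA p q \<alpha> \<mu> \<nu> = ereal (uA - q * uB + p) \<and>
           exp_payoffB uB p q \<alpha> \<mu> \<nu> = 0))"
proof (intro conjI impI)
  note params = assms(1,2,5,6,3,4)
  {
    assume "(uA + p) / q \<le> 0"
    then have "uA + p \<le> 0"
      using \<open>q > 0\<close> by (simp add: divide_le_0_iff)
    then have ex: "pure_equilibrium uA uB p q \<alpha> 0 0"
      using params by (intro pure_equilibrium_zero)
    then show "\<exists>!(xA, xB). pure_equilibrium uA uB p q \<alpha> xA xB"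
      using pure_equilibrium_imp_zero params by (intro ex1I[of _ "(0, 0)"]) auto
    show "\<forall>xA xB. pure_equilibrium uA uB p q \<alpha> xA xB \<longrightarrow>
           xA = 0 \<and> xB = 0 \<and>
           exp_payoffA uA p q \<alpha> (return borel xA) (return borel xB) = 0 \<and>
           exp_payoffB uB p q \<alpha> (return borel xA) (return borel xB) = ereal uB"
    proof (intro allI impI)
      fix xA xB assume "pure_equilibrium uA uB p q \<alpha> xA xB"
      then have "xA = 0" "xB = 0"
        using pure_equilibrium_imp_zero params by blast+
      then show "xA = 0 \<and> xB = 0 \<and>
           exp_payoffA uA p q \<alpha> (return borel xA) (return borel xB) = 0 \<and>
           exp_payoffB uB p q \<alpha> (return borel xA) (return borel xB) = ereal uB"
        using assms by (simp add: exp_payoff_return payoffA_def payoffB_def beta_def)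
    qed
  next
    assume T: "0 < (uA + p) / q \<and> (uA + p) / q \<le> uB"
    then have pos: "0 < uA + p"
      using \<open>q > 0\<close> by (simp add: zero_less_divide_iff)
    then show "\<nexists>xA xB. pure_equilibrium uA uB p q \<alpha> xA xB"
      using no_pure_equilibrium params by blast
    \<comment> \<open>For \<open>T = (uA + p) / q\<close> A's bids reach up to \<open>uA\<close>,
      B's atom is \<open>- p / uA\<close>, and A's value is 0.\<close>
    have simps: "q * ((uA + p) / q) = uA + p" "uA + p - p = uA" "1 - (uA + p) / uA = - p / uA"
      "uA - (uA + p) + p = 0"
      using assms by (auto simp: field_simps)
    show "\<exists>\<mu> \<nu>. cdf \<mu> = FA2 uA uB p q \<and> cdf \<nu> = FB2 uA p q \<and>
           equilibrium uA uB p q \<alpha> \<mu> \<nu> \<and>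
           exp_payoffA uA p q \<alpha> \<mu> \<nu> = 0 \<and>
           exp_payoffB uB p q \<alpha> \<mu> \<nu> = ereal (uB - (uA + p) / q)"
    proof (rule mixed_equilibrium[OF params, of "(uA + p) / q", unfolded simps])
      show "0 < (uA + p) / q" "(uA + p) / q \<le> uB"
        using T by simp_all
    qed (use FA2_eq_atom_uniform_cdf[OF \<open>uB > 0\<close> \<open>q > 0\<close> \<open>p < 0\<close> pos]
        FB2_eq_atom_uniform_cdf[OF \<open>uA > 0\<close> \<open>q > 0\<close> pos] in \<open>auto simp: zero_ereal_def\<close>)
  next
    assume T: "(uA + p) / q > uB"
    then have pos: "q * uB < uA + p"
      using \<open>q > 0\<close> by (simp add: field_simps)
    moreover have "0 < q * uB"
      using assms by simp
    ultimately show "\<nexists>xA xB. pure_equilibrium uA uB p q \<alpha> xA xB"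
      using no_pure_equilibrium params by (meson order_less_trans)
    \<comment> \<open>For \<open>T = uB\<close> both A's atom and B's value vanish.\<close>
    have simps: "1 - uB / uB = 0" "uB - uB = 0"
      using assms by auto
    show "\<exists>\<mu> \<nu>. cdf \<mu> = FA3 uB p q \<and> cdf \<nu> = FB3 uA uB q \<and>
           equilibrium uA uB p q \<alpha> \<mu> \<nu> \<and>
           exp_payoffA uA p q \<alpha> \<mu> \<nu> = ereal (uA - q * uB + p) \<and>
           exp_payoffB uB p q \<alpha> \<mu> \<nu> = 0"
    proof (rule mixed_equilibrium[OF params, of uB, unfolded simps])
      show "0 < uB" "q * uB \<le> uA + p"
        using \<open>uB > 0\<close> pos by simp_all
    qed (use FA3_eq_atom_uniform_cdf[OF \<open>uB > 0\<close> \<open>q > 0\<close> \<open>p < 0\<close>]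
        FB3_eq_atom_uniform_cdf[OF \<open>uB > 0\<close> \<open>uA > 0\<close>] in \<open>auto simp: zero_ereal_def\<close>)
  }
qed

end
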